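(* Let $X=X_1\ldots X_n$ and $Y=Y_1\ldots Y_n$ be two independent i.i.d. random strings over $\{a,b\}$ with the same letter distribution, and let $p_a=P(X_1=a)\in(0,1)$. For any real numbers $a_0,a_1,a_2,a_3,a_4$ let $S=a_0S_0+a_1S_1+a_2S_2+a_3S_3+a_4S_4$, where $S_0,\ldots,S_4$ are the scoring functions on $\{a,b,G\}$ given by the matrices (rows and columns indexed by $a,b,G$ in this order) $$S_0=\begin{pmatrix}1&1&1/2\\1&1&1/2\\1/2&1/2&0\end{pmatrix},\quad S_1=\begin{pmatrix}1&0&1/2\\0&-1&-1/2\\1/2&-1/2&0\end{pmatrix},\quad S_2=\begin{pmatrix}1&-1&0\\-1&1&0\\0&0&0\end{pmatrix},$$ $$S_3=\begin{pmatrix}0&0&1\\0&0&-1\\1&-1&0\end{pmatrix},\quad S_4=\begin{pmatrix}0&0&1\\0&0&1\\1&1&0\end{pmatrix}.$$ Then every symmetric scoring function on $\{a,b,G\}$ with $S(G,G)=0$ can be written in this form, the alignment score of $X$ and $Y$ according to $a_0S_0+a_1S_1$ is the same for every alignment, and $$L_n(S)=(a_0-a_1)\,n+a_1N_n^a+L_n(a_2S_2+a_3S_3+a_4S_4),$$ where $N_n^a$ is the total number of letters $a$ in $X$ and $Y$ combined. Moreover $\frac{N_n^a-2np_a}{\sqrt{2np_a(1-p_a)}}$ converges in law to $\mathcal N(0,1)$ as $n\to\infty$.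
   Context: $G$ denotes the gap symbol. A scoring function is a function $S:\{a,b,G\}\times\{a,b,G\}\to\mathbb R$, identified with a $3\times3$ matrix. An alignment with gaps $\pi$ of strings $x_1\ldots x_n$ and $y_1\ldots y_n$ consists of an integer $0\le i\le n$ and increasing integer sequences $1\le\nu_1<\cdots<\nu_i\le n$ and $1\le\mu_1<\cdots<\mu_i\le n$: the letter $x_{\nu_j}$ is aligned with $y_{\mu_j}$ for $j=1,\ldots,i$, and every remaining letter of either string is aligned with a gap (gaps are never aligned with gaps). The alignment score $S_\pi(x,y)$ is the sum of $S$ over all aligned pairs of symbols, including the pairs (letter, gap). $L_n(S)=\max_\pi S_\pi(X,Y)$ is the optimal alignment score. *)

theory Defs
  imports "HOL-Probability.Probability"
begin

datatype letter = A | B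

datatype symbol = Letter letter | Gap

type_synonym scoring = "symbol \<Rightarrow> symbol \<Rightarrow> real"

fun symbol_index :: "symbol \<Rightarrow> nat" where
  "symbol_index (Letter A) = 0"
| "symbol_index (Letter B) = 1"
| "symbol_index Gap = 2"

definition scoring_of_rows :: "real list list \<Rightarrow> scoring" where
  "scoring_of_rows xss s t = xss ! symbol_index s ! symbol_index t"

definition S0 :: scoring where
  "S0 = scoring_of_rows
     [[  1,   1, 1/2],
      [  1,   1, 1/2],
      [1/2, 1/2,   0]]"

definition S1 :: scoring where
  "S1 = scoring_of_rows
     [[  1,    0,  1/2],
      [  0,   -1, -1/2],
      [1/2, -1/2,    0]]"

definition S2 :: scoring where
  "S2 = scoring_of_rows
     [[ 1, -1, 0],
      [-1,  1, 0],
      [ 0,  0, 0]]"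

definition S3 :: scoring where
  "S3 = scoring_of_rows
     [[0,  0,  1],
      [0,  0, -1],
      [1, -1,  0]]"

definition S4 :: scoring where
  "S4 = scoring_of_rows
     [[0, 0, 1],
      [0, 0, 1],
      [1, 1, 0]]"

definition symmetric_scoring :: "scoring \<Rightarrow> bool" where
  "symmetric_scoring S \<longleftrightarrow> (\<forall>s t. S s t = S t s)"

(* A string x_1 ... x_n is a function x :: nat => letter of which only the values at
   1, ..., n matter.  An alignment is the pair of lists ([nu_1, ..., nu_i], [mu_1, ..., mu_i]). *)

definition alignments :: "nat \<Rightarrow> (nat list \<times> nat list) set" where
  "alignments n = {(\<nu>, \<mu>). length \<nu> = length \<mu> \<and> length \<nu> \<le> n \<and>
     sorted_wrt (<) \<nu> \<and> sorted_wrt (<) \<mu> \<and> set \<nu> \<subseteq> {1..n} \<and> set \<mu> \<subseteq> {1..n}}"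

definition alignment_score ::
  "scoring \<Rightarrow> nat \<Rightarrow> (nat \<Rightarrow> letter) \<Rightarrow> (nat \<Rightarrow> letter) \<Rightarrow> nat list \<times> nat list \<Rightarrow> real" where
  "alignment_score S n x y = (\<lambda>(\<nu>, \<mu>).
      (\<Sum>j<length \<nu>. S (Letter (x (\<nu> ! j))) (Letter (y (\<mu> ! j))))
    + (\<Sum>k\<in>{1..n} - set \<nu>. S (Letter (x k)) Gap)
    + (\<Sum>k\<in>{1..n} - set \<mu>. S Gap (Letter (y k))))"

definition optimal_score ::
  "scoring \<Rightarrow> nat \<Rightarrow> (nat \<Rightarrow> letter) \<Rightarrow> (nat \<Rightarrow> letter) \<Rightarrow> real" where
  "optimal_score S n x y = Max (alignment_score S n x y ` alignments n)"

lemma finite_alignments: "finite (alignments n)"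
proof (rule finite_subset)
  let ?L = "{xs. set xs \<subseteq> {1..n} \<and> length xs \<le> n}"
  show "alignments n \<subseteq> ?L \<times> ?L"
    by (auto simp: alignments_def)
  show "finite (?L \<times> ?L)"
    by (intro finite_cartesian_product finite_lists_length_le) auto
qed

lemma alignments_nonempty: "alignments n \<noteq> {}"
proof -
  have "([], []) \<in> alignments n"
    by (simp add: alignments_def)
  then show ?thesis by blast
qed

definition count_a :: "nat \<Rightarrow> (nat \<Rightarrow> letter) \<Rightarrow> (nat \<Rightarrow> letter) \<Rightarrow> nat" where
  "count_a n x y = card {i \<in> {1..n}. x i = A} + card {i \<in> {1..n}. y i = A}"

(* On a two-letter alphabet, the probability p of the letter a determines the letter distribution. *)

definition iid_string :: "'w measure \<Rightarrow> real \<Rightarrow> nat \<Rightarrow> (nat \<Rightarrow> 'w \<Rightarrow> letter) \<Rightarrow> bool" where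
  "iid_string M p n X \<longleftrightarrow>
     prob_space.indep_vars M (\<lambda>_. count_space UNIV) X {1..n} \<and>
     (\<forall>i\<in>{1..n}. measure M {\<omega> \<in> space M. X i \<omega> = A} = p)"

definition indep_strings ::
  "'w measure \<Rightarrow> nat \<Rightarrow> (nat \<Rightarrow> 'w \<Rightarrow> letter) \<Rightarrow> (nat \<Rightarrow> 'w \<Rightarrow> letter) \<Rightarrow> bool" where
  "indep_strings M n X Y \<longleftrightarrow>
     prob_space.indep_var M
       (PiM {1..n} (\<lambda>_. count_space UNIV)) (\<lambda>\<omega>. \<lambda>i\<in>{1..n}. X i \<omega>)
       (PiM {1..n} (\<lambda>_. count_space UNIV)) (\<lambda>\<omega>. \<lambda>i\<in>{1..n}. Y i \<omega>)"

end

theory Submission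
  imports Defs
begin

text \<open>
  The scores \<open>S0\<close> and \<open>S1\<close> are separable: on each of them an aligned pair of letters contributes
  \<open>w c + w d\<close> and a letter facing a gap contributes \<open>w c\<close>, for a weight \<open>w\<close> on letters.  Under such a
  score every letter of the two strings contributes its weight exactly once, whatever it is aligned
  with, so the total does not depend on the alignment (\<open>alignment_score_separable\<close>).  For
  \<open>a0 S0 + a1 S1\<close> the weights are \<open>(a0 + a1) / 2\<close> for \<open>a\<close> and \<open>(a0 - a1) / 2\<close> for \<open>b\<close>, which gives the
  total \<open>(a0 - a1) n + a1 N\<close>, where \<open>N\<close> is the number of letters \<open>a\<close>.  A summand that is constant
  over the alignments can be pulled out of the maximum, whence the formula for the optimal score.
  That the five matrices span the symmetric scores vanishing at a pair of gaps is a linear system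
  of five equations with an explicit solution.

  The number of letters \<open>a\<close>, centred, is a sum of \<open>2 n\<close> independent centred Bernoulli variables.  The
  strings of different lengths may live on unrelated probability spaces, so the rows form a
  triangular array; the classical central limit theorem speaks of partial sums of one sequence.
  But convergence in law involves only the laws of the row sums, and these are determined by their
  characteristic functions, which are powers of the characteristic function of one fixed law.  The
  partial sums of the coordinates on an infinite product space have the same characteristic
  functions, and the classical theorem applies to them (\<open>clt_of_char_power\<close>).
\<close>

section \<open>Alignment scores\<close>

lemma sum_nth_strict_sorted:
  fixes f :: "'a::linorder \<Rightarrow> 'b::comm_monoid_add"
  assumes "sorted_wrt (<) xs"
  shows "(\<Sum>j<length xs. f (xs ! j)) = sum f (set xs)"
proof -
  have "(\<Sum>j<length xs. f (xs ! j)) = sum_list (map f xs)"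
    by (simp add: sum_list_sum_nth atLeast0LessThan)
  also have "\<dots> = sum f (set xs)"
    using assms by (simp add: strict_sorted_iff sum_list_distinct_conv_sum_set)
  finally show ?thesis .
qed

text \<open>The positions \<open>1..n\<close> of each string split into the aligned ones and those facing a gap, and a
  position contributes the weight of its letter in either case.\<close>

lemma alignment_score_separable:
  assumes \<pi>: "\<pi> \<in> alignments n"
    and pair: "\<And>c d. S (Letter c) (Letter d) = w c + w d"
    and gap: "\<And>c. S (Letter c) Gap = w c" "\<And>c. S Gap (Letter c) = w c"
  shows "alignment_score S n x y \<pi> = (\<Sum>k=1..n. w (x k)) + (\<Sum>k=1..n. w (y k))"
proof -
  obtain \<nu> \<mu> where [simp]: "\<pi> = (\<nu>, \<mu>)" by (cases \<pi>)
  have len: "length \<nu> = length \<mu>" and sub: "set \<nu> \<subseteq> {1..n}" "set \<mu> \<subseteq> {1..n}"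
    and srt: "sorted_wrt (<) \<nu>" "sorted_wrt (<) \<mu>"
    using \<pi> by (auto simp: alignments_def)
  have aligned: "(\<Sum>j<length \<nu>. w (x (\<nu> ! j))) = (\<Sum>k\<in>set \<nu>. w (x k))"
    "(\<Sum>j<length \<nu>. w (y (\<mu> ! j))) = (\<Sum>k\<in>set \<mu>. w (y k))"
    using sum_nth_strict_sorted[OF srt(1), of "\<lambda>k. w (x k)"]
      sum_nth_strict_sorted[OF srt(2), of "\<lambda>k. w (y k)"] len by simp_all
  have "(\<Sum>k\<in>{1..n} - set \<nu>. w (x k)) + (\<Sum>k\<in>set \<nu>. w (x k)) = (\<Sum>k=1..n. w (x k))"
    "(\<Sum>k\<in>{1..n} - set \<mu>. w (y k)) + (\<Sum>k\<in>set \<mu>. w (y k)) = (\<Sum>k=1..n. w (y k))"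
    using sub by (auto intro!: sum.subset_diff[symmetric])
  then show ?thesis
    by (simp add: alignment_score_def pair gap sum.distrib aligned)
qed

lemma alignment_score_add:
  "alignment_score (\<lambda>s t. S s t + T s t) n x y \<pi> =
     alignment_score S n x y \<pi> + alignment_score T n x y \<pi>"
  by (cases \<pi>) (simp add: alignment_score_def sum.distrib)

lemma optimal_score_add_constant:
  assumes "\<And>\<pi>. \<pi> \<in> alignments n \<Longrightarrow> alignment_score S n x y \<pi> = c"
  shows "optimal_score (\<lambda>s t. S s t + T s t) n x y = c + optimal_score T n x y"
proof -
  have "alignment_score (\<lambda>s t. S s t + T s t) n x y ` alignments n =
      (\<lambda>\<pi>. alignment_score T n x y \<pi> + c) ` alignments n"
    by (intro image_cong refl) (simp add: alignment_score_add assms)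
  then show ?thesis
    unfolding optimal_score_def
    by (simp add: Max_add_commute[OF finite_alignments alignments_nonempty])
qed

lemmas scoring_basis_defs = S0_def S1_def S2_def S3_def S4_def scoring_of_rows_def

text \<open>The witnesses solve the five equations from the entries at \<open>(a,a)\<close>, \<open>(a,b)\<close>, \<open>(b,b)\<close>,
  \<open>(a,G)\<close>, \<open>(b,G)\<close>: the first three determine \<open>b0\<close>, \<open>b1\<close>, \<open>b2\<close>, and the gap entries then determine
  \<open>b3\<close> and \<open>b4\<close>.\<close>

lemma symmetric_scoring_decomposition:
  assumes sym: "symmetric_scoring T" and gap: "T Gap Gap = 0"
  shows "\<exists>b0 b1 b2 b3 b4 :: real.
    T = (\<lambda>s t. b0 * S0 s t + b1 * S1 s t + b2 * S2 s t + b3 * S3 s t + b4 * S4 s t)"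
proof -
  let ?aa = "T (Letter A) (Letter A)" and ?ab = "T (Letter A) (Letter B)"
    and ?bb = "T (Letter B) (Letter B)" and ?ag = "T (Letter A) Gap" and ?bg = "T (Letter B) Gap"
  let ?b0 = "(?aa + 2 * ?ab + ?bb) / 4" and ?b1 = "(?aa - ?bb) / 2"
    and ?b2 = "(?aa - 2 * ?ab + ?bb) / 4"
  let ?b3 = "(?ag - ?bg - ?b1) / 2" and ?b4 = "(?ag + ?bg - ?b0) / 2"
  have "T (Letter B) (Letter A) = ?ab" "T Gap (Letter A) = ?ag" "T Gap (Letter B) = ?bg"
    using sym by (simp_all add: symmetric_scoring_def)
  then have "T s t = ?b0 * S0 s t + ?b1 * S1 s t + ?b2 * S2 s t + ?b3 * S3 s t + ?b4 * S4 s t"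
    for s t
    using gap by (cases s rule: symbol_index.cases; cases t rule: symbol_index.cases)
      (simp_all add: scoring_basis_defs field_simps)
  then show ?thesis by blast
qed

lemma alignment_score_S0_S1:
  assumes "\<pi> \<in> alignments n"
  shows "alignment_score (\<lambda>s t. a0 * S0 s t + a1 * S1 s t) n x y \<pi> =
    (a0 - a1) * real n + a1 * real (count_a n x y)"
proof -
  define w where "w c = (a0 - a1) / 2 + a1 * of_bool (c = A)" for c
  have separated: "alignment_score (\<lambda>s t. a0 * S0 s t + a1 * S1 s t) n x y \<pi> =
      (\<Sum>k=1..n. w (x k)) + (\<Sum>k=1..n. w (y k))"
  proof (rule alignment_score_separable[OF assms])
    fix c d
    show "a0 * S0 (Letter c) (Letter d) + a1 * S1 (Letter c) (Letter d) = w c + w d"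
      "a0 * S0 (Letter c) Gap + a1 * S1 (Letter c) Gap = w c"
      "a0 * S0 Gap (Letter c) + a1 * S1 Gap (Letter c) = w c"
      by (cases c; cases d; simp add: w_def scoring_basis_defs field_simps)+
  qed
  have weights: "(\<Sum>k=1..n. w (z k)) =
      (a0 - a1) / 2 * real n + a1 * real (card {i \<in> {1..n}. z i = A})" for z
    by (simp add: w_def sum.distrib sum_distrib_left[symmetric] of_bool_def sum.If_cases Int_def)
  show ?thesis
    unfolding separated weights count_a_def by (simp add: algebra_simps)
qed

section \<open>A central limit theorem for rows on varying probability spaces\<close>

lemma indep_vars_coordinates:
  fixes \<mu> :: "'a measure"
  assumes "prob_space \<mu>"
  shows "prob_space.indep_vars (PiM (UNIV :: 'i set) (\<lambda>_. \<mu>)) (\<lambda>_. \<mu>) (\<lambda>i \<omega>. \<omega> i) UNIV"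
proof -
  interpret product_prob_space "\<lambda>_::'i. \<mu>" UNIV
    by (intro product_prob_spaceI assms)
  show ?thesis
    by (subst P.indep_vars_iff_distr_eq_PiM)
      (auto simp: PiM_component restrict_def distr_id2)
qed

text \<open>On an infinite product of copies of \<open>\<mu>\<close> the sum of the first \<open>m\<close> coordinates has characteristic
  function \<open>char \<mu> ^ m\<close>, so by Levy's uniqueness theorem it has the law of \<open>Z n\<close> when \<open>m = k n\<close>.\<close>

lemma clt_of_char_power:
  fixes \<mu> :: "real measure" and M :: "nat \<Rightarrow> 'w measure" and Z :: "nat \<Rightarrow> 'w \<Rightarrow> real"
  assumes \<mu>: "real_distribution \<mu>"
    and mean: "(LINT x|\<mu>. x) = 0"
    and sq: "integrable \<mu> (\<lambda>x. x\<^sup>2)"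
    and var: "(LINT x|\<mu>. x\<^sup>2) = \<sigma>\<^sup>2" and \<sigma>: "\<sigma> > 0"
    and M: "\<And>n. prob_space (M n)"
    and Z: "\<And>n. Z n \<in> borel_measurable (M n)"
    and ch: "\<And>n t. char (distr (M n) borel (Z n)) t = char \<mu> t ^ k n"
    and k: "filterlim k at_top sequentially"
  shows "weak_conv_m (\<lambda>n. distr (M n) borel (\<lambda>\<omega>. Z n \<omega> / sqrt (real (k n) * \<sigma>\<^sup>2)))
    std_normal_distribution"
proof -
  interpret \<mu>: real_distribution \<mu> by (fact \<mu>)
  interpret product_prob_space "\<lambda>_::nat. \<mu>" UNIV
    by (intro product_prob_spaceI) unfold_locales
  let ?P = "PiM (UNIV :: nat set) (\<lambda>_. \<mu>)"
  have coord [measurable]: "(\<lambda>\<omega>. \<omega> i) \<in> borel_measurable ?P" for i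
    using measurable_component_singleton[of i UNIV "\<lambda>_. \<mu>"]
    by (simp cong: measurable_cong_sets)
  have ind: "P.indep_vars (\<lambda>_. borel) (\<lambda>i \<omega>. \<omega> i) UNIV"
    using P.indep_vars_compose2[OF indep_vars_coordinates[OF \<mu>.prob_space_axioms],
        of "\<lambda>_ x. x" "\<lambda>_. borel"] by simp
  have law: "distr ?P borel (\<lambda>\<omega>. \<omega> i) = \<mu>" for i
    using PiM_component[of i] by (simp cong: distr_cong)
  have E: "P.expectation (\<lambda>\<omega>. f (\<omega> i)) = (LINT x|\<mu>. f x)" if "f \<in> borel_measurable borel"
    for f :: "real \<Rightarrow> real" and i
    using that by (subst law[of i, symmetric]) (simp add: integral_distr)
  have mean': "P.expectation (\<lambda>\<omega>. \<omega> i) = 0" for i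
    using E[of "\<lambda>x. x" i] mean by simp
  have "weak_conv_m (\<lambda>m. distr ?P borel (\<lambda>\<omega>. (\<Sum>i<m. \<omega> i) / sqrt (real m * \<sigma>\<^sup>2)))
      std_normal_distribution"
  proof (rule P.central_limit_theorem_zero_mean[OF ind mean' \<sigma> _ _ law])
    show "integrable ?P (\<lambda>\<omega>. (\<omega> i)\<^sup>2)" for i
      using sq by (subst (asm) law[of i, symmetric]) (simp add: integrable_distr_eq)
    show "P.variance (\<lambda>\<omega>. \<omega> i) = \<sigma>\<^sup>2" for i
      using E[of "\<lambda>x. x\<^sup>2" i] var by (simp add: mean')
  qed
  then have lim: "weak_conv_m
      (\<lambda>n. distr ?P borel (\<lambda>\<omega>. (\<Sum>i<k n. \<omega> i) / sqrt (real (k n) * \<sigma>\<^sup>2)))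
      std_normal_distribution"
    unfolding weak_conv_m_def weak_conv_def
    by (auto intro: filterlim_compose[OF _ k])
  have "distr (M n) borel (Z n) = distr ?P borel (\<lambda>\<omega>. \<Sum>i<k n. \<omega> i)" for n
  proof (rule Levy_uniqueness)
    show "real_distribution (distr (M n) borel (Z n))"
      using prob_space.real_distribution_distr[OF M Z] .
    show "real_distribution (distr ?P borel (\<lambda>\<omega>. \<Sum>i<k n. \<omega> i))"
      by (intro P.real_distribution_distr) measurable
    show "char (distr (M n) borel (Z n)) = char (distr ?P borel (\<lambda>\<omega>. \<Sum>i<k n. \<omega> i))"
      using P.char_distr_sum[OF P.indep_vars_subset[OF ind subset_UNIV]]
      by (simp add: fun_eq_iff ch law)
  qed
  then have "distr (distr (M n) borel (Z n)) borel (\<lambda>z. z / sqrt (real (k n) * \<sigma>\<^sup>2)) =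
      distr (distr ?P borel (\<lambda>\<omega>. \<Sum>i<k n. \<omega> i)) borel (\<lambda>z. z / sqrt (real (k n) * \<sigma>\<^sup>2))" for n
    by simp
  then show ?thesis
    using lim Z by (simp add: distr_distr comp_def)
qed

section \<open>The number of letters a in two random strings\<close>

abbreviation centred_bernoulli :: "real \<Rightarrow> real measure" where
  "centred_bernoulli p \<equiv> distr (measure_pmf (bernoulli_pmf p)) borel (\<lambda>b. of_bool b - p)"

definition centred_indicator :: "real \<Rightarrow> letter \<Rightarrow> real" where
  "centred_indicator p c = of_bool (c = A) - p"

lemma (in prob_space) distr_centred_indicator:
  assumes X: "X \<in> measurable M (count_space UNIV)"
    and p: "prob {\<omega> \<in> space M. X \<omega> = A} = p"
  shows "distr M borel (\<lambda>\<omega>. centred_indicator p (X \<omega>)) = centred_bernoulli p"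
proof -
  have p01: "0 \<le> p" "p \<le> 1" using p by auto
  have XA [measurable]: "(\<lambda>\<omega>. X \<omega> = A) \<in> measurable M (count_space UNIV)"
    using measurable_compose[OF X, of "\<lambda>c. c = A" "count_space UNIV"] by simp
  let ?D = "distr M (count_space UNIV) (\<lambda>\<omega>. X \<omega> = A)"
  have "?D = measure_pmf (bernoulli_pmf p)"
  proof (rule measure_eqI_finite[of _ UNIV])
    fix b :: bool
    have "prob {\<omega> \<in> space M. X \<omega> \<noteq> A} = 1 - p"
      using prob_neg[of "\<lambda>\<omega>. X \<omega> = A"] p by simp
    then have "measure ?D {b} = pmf (bernoulli_pmf p) b"
      using p p01 by (cases b) (simp_all add: measure_distr vimage_def Int_def conj_commute)
    moreover have "prob_space ?D" by (intro prob_space_distr) simp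
    ultimately show "emeasure ?D {b} = emeasure (measure_pmf (bernoulli_pmf p)) {b}"
      by (simp add: emeasure_pmf_single finite_measure.emeasure_eq_measure prob_space.finite_measure)
  qed auto
  then have "centred_bernoulli p = distr ?D borel (\<lambda>b. of_bool b - p)"
    by simp
  also have "\<dots> = distr M borel (\<lambda>\<omega>. centred_indicator p (X \<omega>))"
    by (subst distr_distr) (simp_all add: comp_def centred_indicator_def)
  finally show ?thesis ..
qed

lemma (in prob_space) char_sum_centred_indicator:
  assumes "iid_string M p n X"
  shows "char (distr M borel (\<lambda>\<omega>. \<Sum>i=1..n. centred_indicator p (X i \<omega>))) t =
    char (centred_bernoulli p) t ^ n"
proof -
  have ind: "indep_vars (\<lambda>_. count_space UNIV) X {1..n}"
    and p: "\<And>i. i \<in> {1..n} \<Longrightarrow> prob {\<omega> \<in> space M. X i \<omega> = A} = p"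
    using assms by (auto simp: iid_string_def)
  have "indep_vars (\<lambda>_. borel) (\<lambda>i \<omega>. centred_indicator p (X i \<omega>)) {1..n}"
    by (rule indep_vars_compose2[OF ind]) simp
  moreover have "distr M borel (\<lambda>\<omega>. centred_indicator p (X i \<omega>)) = centred_bernoulli p"
    if "i \<in> {1..n}" for i
    using that ind by (intro distr_centred_indicator p) (auto simp: indep_vars_def2)
  ultimately show ?thesis
    by (simp add: char_distr_sum)
qed

text \<open>Each sum is a measurable function of its whole string.  Independence of the two strings as random
  vectors therefore suffices to multiply the two characteristic functions, and joint independence
  of the \<open>2 n\<close> letters need not be derived.\<close>

lemma (in prob_space) indep_var_sum_centred_indicator:
  assumes "indep_strings M n X Y"
  shows "indep_var borel (\<lambda>\<omega>. \<Sum>i=1..n. centred_indicator p (X i \<omega>))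
    borel (\<lambda>\<omega>. \<Sum>i=1..n. centred_indicator p (Y i \<omega>))"
proof -
  let ?P = "PiM {1..n} (\<lambda>_. count_space UNIV :: letter measure)"
  have [measurable]: "centred_indicator p \<in> borel_measurable (count_space UNIV)"
    by simp
  have "(\<lambda>x. \<Sum>i=1..n. centred_indicator p (x i)) \<in> borel_measurable ?P"
    by measurable
  from indep_var_compose[OF assms[unfolded indep_strings_def] this this]
  show ?thesis by (simp add: comp_def)
qed

lemma count_a_centred:
  "real (count_a n x y) - 2 * real n * p =
    (\<Sum>i=1..n. centred_indicator p (x i)) + (\<Sum>i=1..n. centred_indicator p (y i))"
proof -
  have "(\<Sum>i=1..n. centred_indicator p (z i)) = real (card {i \<in> {1..n}. z i = A}) - real n * p" for z
    by (simp add: centred_indicator_def sum_subtractf of_bool_def sum.If_cases Int_def)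
  then show ?thesis by (simp add: count_a_def)
qed

lemma clt_count_a:
  assumes M: "\<And>n. prob_space (M n)" and p: "0 < p" "p < 1"
    and X: "\<And>n. iid_string (M n) p n (X n)"
    and Y: "\<And>n. iid_string (M n) p n (Y n)"
    and XY: "\<And>n. indep_strings (M n) n (X n) (Y n)"
  shows "weak_conv_m
       (\<lambda>n. distr (M n) borel
          (\<lambda>\<omega>. (real (count_a n (\<lambda>i. X n i \<omega>) (\<lambda>i. Y n i \<omega>)) - 2 * real n * p)
                 / sqrt (2 * real n * p * (1 - p))))
       std_normal_distribution"
proof -
  let ?\<mu> = "centred_bernoulli p" and ?\<sigma> = "sqrt (p * (1 - p))"
  let ?U = "\<lambda>n \<omega>. \<Sum>i=1..n. centred_indicator p (X n i \<omega>)"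
    and ?V = "\<lambda>n \<omega>. \<Sum>i=1..n. centred_indicator p (Y n i \<omega>)"
  have ind: "prob_space.indep_var (M n) borel (?U n) borel (?V n)" for n
    by (rule prob_space.indep_var_sum_centred_indicator[OF M XY])
  have "weak_conv_m (\<lambda>n. distr (M n) borel
      (\<lambda>\<omega>. (?U n \<omega> + ?V n \<omega>) / sqrt (real (2 * n) * ?\<sigma>\<^sup>2))) std_normal_distribution"
  proof (rule clt_of_char_power[where \<mu> = ?\<mu>, OF _ _ _ _ _ M])
    show "real_distribution ?\<mu>"
      by (intro prob_space.real_distribution_distr measure_pmf.prob_space_axioms) simp
    show "(LINT x|?\<mu>. x) = 0"
      using p by (simp add: integral_distr algebra_simps)
    show "integrable ?\<mu> (\<lambda>x. x\<^sup>2)"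
      by (simp add: integrable_distr_eq integrable_measure_pmf_finite)
    show "(LINT x|?\<mu>. x\<^sup>2) = ?\<sigma>\<^sup>2"
      using p by (simp add: integral_distr power2_eq_square algebra_simps)
    show "?\<sigma> > 0" using p by simp
    show "(\<lambda>\<omega>. ?U n \<omega> + ?V n \<omega>) \<in> borel_measurable (M n)" for n
      using prob_space.indep_var_rv1[OF M ind] prob_space.indep_var_rv2[OF M ind]
      by (intro borel_measurable_add)
    show "char (distr (M n) borel (\<lambda>\<omega>. ?U n \<omega> + ?V n \<omega>)) t = char ?\<mu> t ^ (2 * n)" for n t
      unfolding prob_space.char_distr_add[OF M ind] prob_space.char_sum_centred_indicator[OF M X]
        prob_space.char_sum_centred_indicator[OF M Y] by (simp add: mult_2 power_add)
    show "filterlim (\<lambda>n. 2 * n) at_top sequentially"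
      by (intro filterlim_subseq strict_monoI) simp
  qed
  then show ?thesis
    unfolding count_a_centred using p by (simp add: mult.assoc)
qed

theorem mainTheorem2:
  fixes M :: "nat \<Rightarrow> 'w measure"
    and X Y :: "nat \<Rightarrow> nat \<Rightarrow> 'w \<Rightarrow> letter"
    and p a0 a1 a2 a3 a4 :: real
    and S :: scoring
  assumes "\<And>n. prob_space (M n)"
    and "0 < p" and "p < 1"
    and "\<And>n. iid_string (M n) p n (X n)"
    and "\<And>n. iid_string (M n) p n (Y n)"
    and "\<And>n. indep_strings (M n) n (X n) (Y n)"
    and "S = (\<lambda>s t. a0 * S0 s t + a1 * S1 s t + a2 * S2 s t + a3 * S3 s t + a4 * S4 s t)"
  shows
    "(\<forall>T. symmetric_scoring T \<and> T Gap Gap = 0 \<longrightarrow>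
        (\<exists>b0 b1 b2 b3 b4 :: real.
           T = (\<lambda>s t. b0 * S0 s t + b1 * S1 s t + b2 * S2 s t + b3 * S3 s t + b4 * S4 s t))) \<and>
     (\<forall>n. \<forall>\<omega>\<in>space (M n). \<forall>\<pi>\<in>alignments n. \<forall>\<rho>\<in>alignments n.
        alignment_score (\<lambda>s t. a0 * S0 s t + a1 * S1 s t) n (\<lambda>i. X n i \<omega>) (\<lambda>i. Y n i \<omega>) \<pi> =
        alignment_score (\<lambda>s t. a0 * S0 s t + a1 * S1 s t) n (\<lambda>i. X n i \<omega>) (\<lambda>i. Y n i \<omega>) \<rho>) \<and>
     (\<forall>n. \<forall>\<omega>\<in>space (M n).
        optimal_score S n (\<lambda>i. X n i \<omega>) (\<lambda>i. Y n i \<omega>) =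
          (a0 - a1) * real n
          + a1 * real (count_a n (\<lambda>i. X n i \<omega>) (\<lambda>i. Y n i \<omega>))
          + optimal_score (\<lambda>s t. a2 * S2 s t + a3 * S3 s t + a4 * S4 s t) n
              (\<lambda>i. X n i \<omega>) (\<lambda>i. Y n i \<omega>)) \<and>
     weak_conv_m
       (\<lambda>n. distr (M n) borel
          (\<lambda>\<omega>. (real (count_a n (\<lambda>i. X n i \<omega>) (\<lambda>i. Y n i \<omega>)) - 2 * real n * p)
                 / sqrt (2 * real n * p * (1 - p))))
       std_normal_distribution"
proof (intro conjI allI ballI impI)
  show "\<exists>b0 b1 b2 b3 b4 :: real.
      T = (\<lambda>s t. b0 * S0 s t + b1 * S1 s t + b2 * S2 s t + b3 * S3 s t + b4 * S4 s t)"
    if "symmetric_scoring T \<and> T Gap Gap = 0" for T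
    using that by (intro symmetric_scoring_decomposition) auto
next
  show "alignment_score (\<lambda>s t. a0 * S0 s t + a1 * S1 s t) n (\<lambda>i. X n i \<omega>) (\<lambda>i. Y n i \<omega>) \<pi> =
      alignment_score (\<lambda>s t. a0 * S0 s t + a1 * S1 s t) n (\<lambda>i. X n i \<omega>) (\<lambda>i. Y n i \<omega>) \<rho>"
    if "\<pi> \<in> alignments n" "\<rho> \<in> alignments n" for n \<omega> \<pi> \<rho>
    using that by (simp add: alignment_score_S0_S1)
next
  have "S = (\<lambda>s t. (a0 * S0 s t + a1 * S1 s t) + (a2 * S2 s t + a3 * S3 s t + a4 * S4 s t))"
    using assms(7) by (simp add: add.assoc)
  then show "optimal_score S n (\<lambda>i. X n i \<omega>) (\<lambda>i. Y n i \<omega>) =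
      (a0 - a1) * real n
      + a1 * real (count_a n (\<lambda>i. X n i \<omega>) (\<lambda>i. Y n i \<omega>))
      + optimal_score (\<lambda>s t. a2 * S2 s t + a3 * S3 s t + a4 * S4 s t) n
          (\<lambda>i. X n i \<omega>) (\<lambda>i. Y n i \<omega>)" for n \<omega>
    by (simp only: optimal_score_add_constant[OF alignment_score_S0_S1])
next
  show "weak_conv_m
       (\<lambda>n. distr (M n) borel
          (\<lambda>\<omega>. (real (count_a n (\<lambda>i. X n i \<omega>) (\<lambda>i. Y n i \<omega>)) - 2 * real n * p)
                 / sqrt (2 * real n * p * (1 - p))))
       std_normal_distribution"
    using assms(1-6) by (rule clt_count_a)
qed

end
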